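(* For all integers $n,m\ge 1$, the following sets of $n\times m$ matrices coincide: $$\mathsf{TN}^{\mathrm{trop}}_2(\mathbb{R})=\mathsf{TN}^{\mathrm{trop}}(\mathbb{R})=\operatorname{val}\big(\mathsf{TN}(\mathbb{K}^* )\big)=\operatorname{val}(\mathsf{TP}).$$
   Context: $\mathbb{K}$ is the field of generalized Puiseux series with real coefficients and real exponents: series $f=\sum_{k\ge 0}a_kt^{b_k}$ with $a_k\in\mathbb{R}$ and $(b_k)$ a finite sequence, or a strictly decreasing sequence of reals tending to $-\infty$. The valuation $\operatorname{val}(f)$ is the largest exponent with nonzero coefficient, $\operatorname{val}(0)=-\infty$. $\mathbb{K}$ is ordered: a nonzero series is positive if its leading coefficient (that of the largest exponent) is positive. $\mathbb{K}^*=\mathbb{K}\setminus\{0\}$. $\mathsf{TP}$ (resp. $\mathsf{TN}$) is the set of $n\times m$ matrices over $\mathbb{K}$ all of whose minors are positive (resp. nonnegative); $\mathsf{TN}(\mathbb{K}^* )$ is the set of matrices in $\mathsf{TN}$ all of whose entries are nonzero. For a set $S$ of matrices over $\mathbb{K}$, $\operatorname{val}(S)$ is the set of matrices $(\operatorname{val}(\mathbf{A}_{ij}))$ with $\mathbf{A}\in S$. Tropical notions: for a $d\times d$ matrix $M$ with entries in $\mathbb{R}\cup\{-\infty\}$, $\operatorname{per}(M)=\max_{\sigma\in S_d}\sum_{i=1}^dM_{i,\sigma(i)}$; the weight of $\sigma$ is $\sum_iM_{i,\sigma(i)}$. $M$ is sign-nonsingular if $\operatorname{per}(M)\ne-\infty$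 and all permutations of maximum weight have the same parity, and sign-singular otherwise. A tropical minor of a matrix is the tropical permanent of a square submatrix (rows and columns in natural order). It is tropically positive if the submatrix is sign-nonsingular and all maximum-weight permutations are even; it is tropically nonnegative if it is tropically positive or the submatrix is sign-singular. $\mathsf{TN}^{\mathrm{trop}}(\mathbb{R})$ (resp. $\mathsf{TN}^{\mathrm{trop}}_2(\mathbb{R})$) is the set of $n\times m$ matrices with entries in $\mathbb{R}$ all of whose tropical minors (resp. all of whose tropical minors of size at most $2$) are tropically nonnegative. *)

theory Defs
  imports
    "HOL-Library.Extended_Real"
    "Jordan_Normal_Form.Determinant"
    "Jordan_Normal_Form.DL_Submatrix"
begin

section \<open>Generalized Puiseux series with real coefficients and real exponents\<close>

definition puiseux_support :: "real set \<Rightarrow> bool" where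
  "puiseux_support S \<longleftrightarrow>
     finite S \<or>
     (\<exists>b :: nat \<Rightarrow> real. (\<forall>i j. i < j \<longrightarrow> b j < b i) \<and> filterlim b at_bot sequentially \<and> S \<subseteq> range b)"

lemma puiseux_support_iff: "puiseux_support S \<longleftrightarrow> (\<forall>c. finite (S \<inter> {c..}))"
proof
  assume "puiseux_support S"
  then consider "finite S"
    | b :: "nat \<Rightarrow> real" where "filterlim b at_bot sequentially" "S \<subseteq> range b"
    unfolding puiseux_support_def by blast
  then show "\<forall>c. finite (S \<inter> {c..})"
  proof cases
    case 1
    then show ?thesis by simp
  next
    case 2
    show ?thesis
    proof
      fix c
      have "eventually (\<lambda>n. b n < c) sequentially"
        using 2(1) by (simp add: filterlim_at_bot_dense)
      then obtain N where N: "\<And>n. n \<ge> N \<Longrightarrow> b n < c"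
        by (auto simp: eventually_sequentially)
      have "S \<inter> {c..} \<subseteq> b ` {..<N}"
      proof
        fix x assume "x \<in> S \<inter> {c..}"
        then obtain n where "x = b n" "c \<le> b n" using 2(2) by auto
        then show "x \<in> b ` {..<N}" using N[of n] by (cases "n < N") auto
      qed
      then show "finite (S \<inter> {c..})" by (rule finite_subset) simp
    qed
  qed
next
  assume fin: "\<forall>c. finite (S \<inter> {c..})"
  show "puiseux_support S"
  proof (cases "finite S")
    case True
    then show ?thesis by (simp add: puiseux_support_def)
  next
    case False
    define r where "r x = card (S \<inter> {x<..})" for x
    have fin': "finite (S \<inter> {x<..})" for x
      by (rule finite_subset[of _ "S \<inter> {x..}"]) (use fin in auto)
    have mono: "r y < r x" if "x \<in> S" "y \<in> S" "x < y" for x y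
      unfolding r_def by (rule psubset_card_mono[OF fin']) (use that in auto)
    have down: "\<exists>y\<in>S. r y = k" if "x \<in> S" "k \<le> r x" for x k
      using that
    proof (induction "r x" arbitrary: x)
      case 0
      then show ?case by auto
    next
      case (Suc n)
      show ?case
      proof (cases "k = r x")
        case True
        then show ?thesis using Suc by auto
      next
        case False
        have ne: "S \<inter> {x<..} \<noteq> {}" using Suc(2) by (auto simp: r_def)
        define y where "y = Min (S \<inter> {x<..})"
        have y: "y \<in> S \<inter> {x<..}" unfolding y_def using ne fin' by (rule Min_in[rotated])
        have "S \<inter> {x<..} = insert y (S \<inter> {y<..})"
          using y Min_le[OF fin', of _ x] by (fastforce simp: y_def)
        then have "r x = Suc (r y)" using fin' by (simp add: r_def)
        then show ?thesis using Suc(1)[of y] Suc(2,4) y False by auto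
      qed
    qed
    have ex: "\<exists>y\<in>S. r y = k" for k
    proof -
      have inj: "inj_on r S"
        by (rule linorder_inj_onI) (use mono in fastforce)+
      then have "infinite (r ` S)" using False by (simp add: finite_image_iff)
      then obtain n where "n \<in> r ` S" "k \<le> n"
        by (meson infinite_nat_iff_unbounded_le)
      then show ?thesis using down by auto
    qed
    then obtain b where b: "\<And>k. b k \<in> S" "\<And>k. r (b k) = k" by metis
    have dec: "b j < b i" if "i < j" for i j
      using mono[of "b i" "b j"] b that by (metis less_asym linorder_neqE)
    have rng: "S \<subseteq> range b"
    proof
      fix x assume "x \<in> S"
      then have "x = b (r x)" using mono b by (metis less_irrefl linorder_neqE)
      then show "x \<in> range b" by blast
    qed
    have "filterlim b at_bot sequentially"
      unfolding filterlim_at_bot_dense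
    proof
      fix c
      have "infinite (range b)" using rng False finite_subset by blast
      then have "\<not> range b \<subseteq> S \<inter> {c..}" using fin finite_subset by blast
      then obtain N where "b N \<notin> S \<inter> {c..}" by blast
      then have "b N < c" using b(1)[of N] by simp
      then have "b n < c" if "n \<ge> N" for n
        using dec[of N n] that by (cases "n = N") auto
      then show "eventually (\<lambda>n. b n < c) sequentially"
        by (auto simp: eventually_sequentially)
    qed
    then show ?thesis using dec rng unfolding puiseux_support_def by blast
  qed
qed

text \<open>A series is represented by the function sending each exponent to its coefficient; the
  exponents with nonzero coefficient have to lie in a sequence as above. The field operations and
  the order are supplied by the class instances below.\<close>

typedef puiseux = "{f :: real \<Rightarrow> real. puiseux_support {x. f x \<noteq> 0}}"
  morphisms pcoeff Abs_puiseux
  by (rule exI[of _ "\<lambda>_. 0"]) (simp add: puiseux_support_def)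

setup_lifting type_definition_puiseux

lemma puiseux_eqI: "(\<And>x. pcoeff f x = pcoeff g x) \<Longrightarrow> f = g"
  by (simp add: pcoeff_inject[symmetric] fun_eq_iff)

lemma pcoeff_finite: "finite {x. pcoeff f x \<noteq> 0 \<and> c \<le> x}"
proof -
  have "finite ({x. pcoeff f x \<noteq> 0} \<inter> {c..})"
    using pcoeff[of f] by (simp add: puiseux_support_iff)
  then show ?thesis by (simp add: Collect_conj_eq atLeast_def)
qed

lemma puiseux_supportI: "(\<And>c. finite {x. f x \<noteq> 0 \<and> c \<le> x}) \<Longrightarrow> puiseux_support {x. f x \<noteq> 0}"
  by (simp add: puiseux_support_iff Collect_conj_eq atLeast_def)

lemma puiseux_supportD: "puiseux_support {x. f x \<noteq> 0} \<Longrightarrow> finite {x. f x \<noteq> 0 \<and> c \<le> x}"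
  by (simp add: puiseux_support_iff Collect_conj_eq atLeast_def)

lemma puiseux_support_bdd:
  assumes "puiseux_support {x. f x \<noteq> 0}"
  obtains M where "\<And>x. f x \<noteq> 0 \<Longrightarrow> x \<le> M"
proof -
  let ?S = "insert 0 {x. f x \<noteq> 0 \<and> 0 \<le> x}"
  have "x \<le> Max ?S" if "f x \<noteq> 0" for x
  proof (cases "0 \<le> x")
    case True
    then show ?thesis using puiseux_supportD[OF assms] that by (intro Max_ge) auto
  next
    case False
    have "0 \<le> Max ?S" using puiseux_supportD[OF assms] by (intro Max_ge) auto
    then show ?thesis using False by linarith
  qed
  then show ?thesis using that by blast
qed

lemma pcoeff_bdd:
  obtains M where "\<And>x. pcoeff f x \<noteq> 0 \<Longrightarrow> x \<le> M"
  using puiseux_support_bdd[of "pcoeff f"] pcoeff[of f] by auto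

lemma sum_rotate3:
  "(\<Sum>b\<in>B. \<Sum>d\<in>C. \<Sum>a\<in>A. F b d a) = (\<Sum>a\<in>A. \<Sum>b\<in>B. \<Sum>d\<in>C. F b d a)"
proof -
  have "(\<Sum>b\<in>B. \<Sum>d\<in>C. \<Sum>a\<in>A. F b d a) = (\<Sum>b\<in>B. \<Sum>a\<in>A. \<Sum>d\<in>C. F b d a)"
    by (intro sum.cong refl sum.swap)
  also have "\<dots> = (\<Sum>a\<in>A. \<Sum>b\<in>B. \<Sum>d\<in>C. F b d a)" by (rule sum.swap)
  finally show ?thesis .
qed

lemma sum_rotate4:
  "(\<Sum>y\<in>D. \<Sum>d\<in>C. \<Sum>a\<in>A. \<Sum>b\<in>B. F y d a b) =
   (\<Sum>a\<in>A. \<Sum>b\<in>B. \<Sum>d\<in>C. \<Sum>y\<in>D. F y d a b)"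
proof -
  have "(\<Sum>y\<in>D. \<Sum>d\<in>C. \<Sum>a\<in>A. \<Sum>b\<in>B. F y d a b) =
      (\<Sum>a\<in>A. \<Sum>y\<in>D. \<Sum>d\<in>C. \<Sum>b\<in>B. F y d a b)"
    by (rule sum_rotate3)
  also have "\<dots> = (\<Sum>a\<in>A. \<Sum>b\<in>B. \<Sum>y\<in>D. \<Sum>d\<in>C. F y d a b)"
    by (intro sum.cong refl sum_rotate3)
  also have "\<dots> = (\<Sum>a\<in>A. \<Sum>b\<in>B. \<Sum>d\<in>C. \<Sum>y\<in>D. F y d a b)"
    by (intro sum.cong refl sum.swap)
  finally show ?thesis .
qed

instantiation puiseux :: comm_ring_1
begin

lift_definition zero_puiseux :: puiseux is "\<lambda>_. 0"
  by (simp add: puiseux_support_def)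

lift_definition one_puiseux :: puiseux is "\<lambda>x. if x = 0 then 1 else 0"
  by (simp add: puiseux_support_def)

lift_definition plus_puiseux :: "puiseux \<Rightarrow> puiseux \<Rightarrow> puiseux" is "\<lambda>f g x. f x + g x"
proof (rule puiseux_supportI)
  fix f g :: "real \<Rightarrow> real" and c
  assume fg: "puiseux_support {x. f x \<noteq> 0}" "puiseux_support {x. g x \<noteq> 0}"
  show "finite {x. f x + g x \<noteq> 0 \<and> c \<le> x}"
    by (rule finite_subset[of _ "{x. f x \<noteq> 0 \<and> c \<le> x} \<union> {x. g x \<noteq> 0 \<and> c \<le> x}"])
      (use fg[THEN puiseux_supportD, of c] in auto)
qed

lift_definition uminus_puiseux :: "puiseux \<Rightarrow> puiseux" is "\<lambda>f x. - f x"
  by simp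

lift_definition minus_puiseux :: "puiseux \<Rightarrow> puiseux \<Rightarrow> puiseux" is "\<lambda>f g x. f x - g x"
proof (rule puiseux_supportI)
  fix f g :: "real \<Rightarrow> real" and c
  assume fg: "puiseux_support {x. f x \<noteq> 0}" "puiseux_support {x. g x \<noteq> 0}"
  show "finite {x. f x - g x \<noteq> 0 \<and> c \<le> x}"
    by (rule finite_subset[of _ "{x. f x \<noteq> 0 \<and> c \<le> x} \<union> {x. g x \<noteq> 0 \<and> c \<le> x}"])
      (use fg[THEN puiseux_supportD, of c] in auto)
qed

text \<open>The Cauchy product. The index set of the sum is always finite, because both supports are
  bounded above.\<close>

lift_definition times_puiseux :: "puiseux \<Rightarrow> puiseux \<Rightarrow> puiseux"
  is "\<lambda>f g x. \<Sum>a | f a \<noteq> 0 \<and> g (x - a) \<noteq> 0. f a * g (x - a)"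
proof (rule puiseux_supportI)
  fix f g :: "real \<Rightarrow> real" and c
  assume fg: "puiseux_support {x. f x \<noteq> 0}" "puiseux_support {x. g x \<noteq> 0}"
  obtain M where M: "\<And>x. f x \<noteq> 0 \<Longrightarrow> x \<le> M" using puiseux_support_bdd[OF fg(1)] by blast
  obtain M' where M': "\<And>x. g x \<noteq> 0 \<Longrightarrow> x \<le> M'" using puiseux_support_bdd[OF fg(2)] by blast
  let ?A = "{x. f x \<noteq> 0 \<and> c - M' \<le> x} \<times> {x. g x \<noteq> 0 \<and> c - M \<le> x}"
  have "{x. (\<Sum>a | f a \<noteq> 0 \<and> g (x - a) \<noteq> 0. f a * g (x - a)) \<noteq> 0 \<and> c \<le> x}
      \<subseteq> (\<lambda>(a, b). a + b) ` ?A"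
  proof
    fix x assume "x \<in> {x. (\<Sum>a | f a \<noteq> 0 \<and> g (x - a) \<noteq> 0. f a * g (x - a)) \<noteq> 0 \<and> c \<le> x}"
    then have nz: "(\<Sum>a | f a \<noteq> 0 \<and> g (x - a) \<noteq> 0. f a * g (x - a)) \<noteq> 0" and cx: "c \<le> x"
      by blast+
    have "{a. f a \<noteq> 0 \<and> g (x - a) \<noteq> 0} \<noteq> {}"
      using nz by (metis (no_types, lifting) sum.empty)
    then obtain a where a: "f a \<noteq> 0" "g (x - a) \<noteq> 0" by blast
    have "(a, x - a) \<in> ?A" using M[OF a(1)] M'[OF a(2)] a cx by auto
    then show "x \<in> (\<lambda>(a, b). a + b) ` ?A" by force
  qed
  then show "finite {x. (\<Sum>a | f a \<noteq> 0 \<and> g (x - a) \<noteq> 0. f a * g (x - a)) \<noteq> 0 \<and> c \<le> x}"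
    by (rule finite_subset) (use fg[THEN puiseux_supportD] in auto)
qed

lemma pcoeff_mult_double_sum:
  assumes A: "finite A" and B: "finite B"
    and cover: "\<And>a b. pcoeff f a \<noteq> 0 \<Longrightarrow> pcoeff g b \<noteq> 0 \<Longrightarrow> a + b = x \<Longrightarrow> a \<in> A \<and> b \<in> B"
  shows "pcoeff (f * g) x = (\<Sum>a\<in>A. \<Sum>b\<in>B. if a + b = x then pcoeff f a * pcoeff g b else 0)"
proof -
  have "pcoeff (f * g) x =
      (\<Sum>a | pcoeff f a \<noteq> 0 \<and> pcoeff g (x - a) \<noteq> 0. pcoeff f a * pcoeff g (x - a))"
    by transfer simp
  also have "\<dots> = (\<Sum>a\<in>A. if x - a \<in> B then pcoeff f a * pcoeff g (x - a) else 0)"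
    by (rule sum.mono_neutral_cong_left) (use A cover in \<open>auto split: if_splits\<close>)
  also have "\<dots> = (\<Sum>a\<in>A. \<Sum>b\<in>B. if a + b = x then pcoeff f a * pcoeff g b else 0)"
  proof (rule sum.cong[OF refl])
    fix a
    have "(\<Sum>b\<in>B. if a + b = x then pcoeff f a * pcoeff g b else 0) =
        (\<Sum>b\<in>B. if x - a = b then pcoeff f a * pcoeff g b else 0)"
      by (rule sum.cong) auto
    then show "(if x - a \<in> B then pcoeff f a * pcoeff g (x - a) else 0) =
        (\<Sum>b\<in>B. if a + b = x then pcoeff f a * pcoeff g b else 0)"
      using B by simp
  qed
  finally show ?thesis .
qed

lemma pcoeff_mult_window:
  assumes "\<And>a. pcoeff f a \<noteq> 0 \<Longrightarrow> a \<le> M" "\<And>b. pcoeff g b \<noteq> 0 \<Longrightarrow> b \<le> M" "c \<le> x - M"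
  shows "pcoeff (f * g) x =
    (\<Sum>a | pcoeff f a \<noteq> 0 \<and> c \<le> a. \<Sum>b | pcoeff g b \<noteq> 0 \<and> c \<le> b.
       if a + b = x then pcoeff f a * pcoeff g b else 0)"
proof (rule pcoeff_mult_double_sum[OF pcoeff_finite pcoeff_finite])
  fix a b assume "pcoeff f a \<noteq> 0" "pcoeff g b \<noteq> 0" "a + b = x"
  then show "a \<in> {a. pcoeff f a \<noteq> 0 \<and> c \<le> a} \<and> b \<in> {b. pcoeff g b \<noteq> 0 \<and> c \<le> b}"
    using assms(1)[of a] assms(2)[of b] assms(3) by auto
qed

lemma pcoeff_mult_nonzero:
  assumes "pcoeff (f * g) x \<noteq> 0"
  obtains a b where "pcoeff f a \<noteq> 0" "pcoeff g b \<noteq> 0" "a + b = x"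
proof -
  have "pcoeff (f * g) x =
      (\<Sum>a | pcoeff f a \<noteq> 0 \<and> pcoeff g (x - a) \<noteq> 0. pcoeff f a * pcoeff g (x - a))"
    by transfer simp
  with assms have "{a. pcoeff f a \<noteq> 0 \<and> pcoeff g (x - a) \<noteq> 0} \<noteq> {}" by (metis sum.empty)
  then obtain a where "pcoeff f a \<noteq> 0" "pcoeff g (x - a) \<noteq> 0" by blast
  then show ?thesis using that[of a "x - a"] by simp
qed

lemma puiseux_mult_commute: "f * g = g * f" for f g :: puiseux
proof (rule puiseux_eqI)
  fix x
  obtain M1 where M1: "\<And>a. pcoeff f a \<noteq> 0 \<Longrightarrow> a \<le> M1" using pcoeff_bdd[of f] by blast
  obtain M2 where M2: "\<And>a. pcoeff g a \<noteq> 0 \<Longrightarrow> a \<le> M2" using pcoeff_bdd[of g] by blast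
  let ?M = "max M1 M2"
  have f: "\<And>a. pcoeff f a \<noteq> 0 \<Longrightarrow> a \<le> ?M" and g: "\<And>a. pcoeff g a \<noteq> 0 \<Longrightarrow> a \<le> ?M"
    using M1 M2 by fastforce+
  show "pcoeff (f * g) x = pcoeff (g * f) x"
  proof -
    have "pcoeff (f * g) x = (\<Sum>a | pcoeff f a \<noteq> 0 \<and> x - ?M \<le> a. \<Sum>b | pcoeff g b \<noteq> 0 \<and> x - ?M \<le> b.
        if a + b = x then pcoeff f a * pcoeff g b else 0)"
      by (rule pcoeff_mult_window[OF f g order_refl])
    also have "\<dots> = (\<Sum>b | pcoeff g b \<noteq> 0 \<and> x - ?M \<le> b. \<Sum>a | pcoeff f a \<noteq> 0 \<and> x - ?M \<le> a.
        if a + b = x then pcoeff f a * pcoeff g b else 0)"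
      by (rule sum.swap)
    also have "\<dots> = (\<Sum>b | pcoeff g b \<noteq> 0 \<and> x - ?M \<le> b. \<Sum>a | pcoeff f a \<noteq> 0 \<and> x - ?M \<le> a.
        if b + a = x then pcoeff g b * pcoeff f a else 0)"
      by (simp only: add.commute mult.commute)
    also have "\<dots> = pcoeff (g * f) x"
      by (rule pcoeff_mult_window[OF g f order_refl, symmetric])
    finally show ?thesis .
  qed
qed

lemma puiseux_mult_assoc: "f * g * h = f * (g * h)" for f g h :: puiseux
proof (rule puiseux_eqI)
  fix x
  have key: "pcoeff (f * g * h) x =
      (\<Sum>a | pcoeff f a \<noteq> 0 \<and> c \<le> a. \<Sum>b | pcoeff g b \<noteq> 0 \<and> c \<le> b. \<Sum>d | pcoeff h d \<noteq> 0 \<and> c \<le> d.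
         if a + b + d = x then pcoeff f a * pcoeff g b * pcoeff h d else 0)"
    if M: "\<And>a. pcoeff f a \<noteq> 0 \<Longrightarrow> a \<le> M" "\<And>a. pcoeff g a \<noteq> 0 \<Longrightarrow> a \<le> M"
      "\<And>a. pcoeff h a \<noteq> 0 \<Longrightarrow> a \<le> M" and c: "c \<le> x - 2 * M" "c \<le> x - M - M" for f g h M c
  proof -
    let ?A = "{a. pcoeff f a \<noteq> 0 \<and> c \<le> a}"
    let ?B = "{b. pcoeff g b \<noteq> 0 \<and> c \<le> b}"
    let ?C = "{d. pcoeff h d \<noteq> 0 \<and> c \<le> d}"
    let ?D = "(\<lambda>(a, b). a + b) ` (?A \<times> ?B)"
    have fin: "finite ?A" "finite ?B" "finite ?C" "finite ?D"
      by (auto intro: pcoeff_finite)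
    have fg: "pcoeff (f * g) y =
        (\<Sum>a\<in>?A. \<Sum>b\<in>?B. if a + b = y then pcoeff f a * pcoeff g b else 0)"
      if "pcoeff h d \<noteq> 0" "y + d = x" for y d
    proof -
      from that have "c \<le> y - M" using M(3)[of d] c by linarith
      then show ?thesis using pcoeff_mult_window[OF M(1,2)] by blast
    qed
    have "pcoeff (f * g * h) x =
        (\<Sum>y\<in>?D. \<Sum>d\<in>?C. if y + d = x then pcoeff (f * g) y * pcoeff h d else 0)"
    proof (rule pcoeff_mult_double_sum[OF fin(4,3)])
      fix y d assume y: "pcoeff (f * g) y \<noteq> 0" and d: "pcoeff h d \<noteq> 0" and yd: "y + d = x"
      obtain a b where ab: "pcoeff f a \<noteq> 0" "pcoeff g b \<noteq> 0" "a + b = y"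
        using pcoeff_mult_nonzero[OF y] .
      have "c \<le> a" "c \<le> b" "c \<le> d"
        using M(1)[OF ab(1)] M(2)[OF ab(2)] M(3)[OF d] ab(3) yd c by linarith+
      then show "y \<in> ?D \<and> d \<in> ?C" using ab d by force
    qed
    also have "\<dots> = (\<Sum>y\<in>?D. \<Sum>d\<in>?C. \<Sum>a\<in>?A. \<Sum>b\<in>?B.
        if a + b = y then (if a + b + d = x then pcoeff f a * pcoeff g b * pcoeff h d else 0) else 0)"
    proof (intro sum.cong refl)
      fix y d assume d: "d \<in> ?C"
      show "(if y + d = x then pcoeff (f * g) y * pcoeff h d else 0) = (\<Sum>a\<in>?A. \<Sum>b\<in>?B.
        if a + b = y then (if a + b + d = x then pcoeff f a * pcoeff g b * pcoeff h d else 0) else 0)"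
      proof (cases "y + d = x")
        case True
        then show ?thesis using fg[of d y] d
          by (auto simp: sum_distrib_right intro!: sum.cong)
      next
        case False
        have "(\<Sum>a\<in>?A. \<Sum>b\<in>?B. if a + b = y then
            (if a + b + d = x then pcoeff f a * pcoeff g b * pcoeff h d else 0) else 0) = 0"
          by (intro sum.neutral ballI) (use False in auto)
        then show ?thesis using False by simp
      qed
    qed
    also have "\<dots> = (\<Sum>a\<in>?A. \<Sum>b\<in>?B. \<Sum>d\<in>?C. \<Sum>y\<in>?D.
        if a + b = y then (if a + b + d = x then pcoeff f a * pcoeff g b * pcoeff h d else 0) else 0)"
      by (rule sum_rotate4)
    also have "\<dots> = (\<Sum>a\<in>?A. \<Sum>b\<in>?B. \<Sum>d\<in>?C.
        if a + b + d = x then pcoeff f a * pcoeff g b * pcoeff h d else 0)"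
      using fin(4) by (intro sum.cong refl) (auto simp: sum.delta')
    finally show ?thesis .
  qed
  obtain M1 where M1: "\<And>a. pcoeff f a \<noteq> 0 \<Longrightarrow> a \<le> M1" using pcoeff_bdd[of f] by blast
  obtain M2 where M2: "\<And>a. pcoeff g a \<noteq> 0 \<Longrightarrow> a \<le> M2" using pcoeff_bdd[of g] by blast
  obtain M3 where M3: "\<And>a. pcoeff h a \<noteq> 0 \<Longrightarrow> a \<le> M3" using pcoeff_bdd[of h] by blast
  define M where "M = max M1 (max M2 M3)"
  define c where "c = x - M - M"
  have f: "\<And>a. pcoeff f a \<noteq> 0 \<Longrightarrow> a \<le> M" and g: "\<And>a. pcoeff g a \<noteq> 0 \<Longrightarrow> a \<le> M"
    and h: "\<And>a. pcoeff h a \<noteq> 0 \<Longrightarrow> a \<le> M"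
    using M1 M2 M3 unfolding M_def by fastforce+
  have c: "c \<le> x - 2 * M" "c \<le> x - M - M" by (auto simp: c_def)
  let ?A = "{a. pcoeff f a \<noteq> 0 \<and> c \<le> a}"
  let ?B = "{b. pcoeff g b \<noteq> 0 \<and> c \<le> b}"
  let ?C = "{d. pcoeff h d \<noteq> 0 \<and> c \<le> d}"
  have "pcoeff (f * (g * h)) x = pcoeff (g * h * f) x"
    by (simp only: puiseux_mult_commute)
  also have "\<dots> = (\<Sum>b\<in>?B. \<Sum>d\<in>?C. \<Sum>a\<in>?A.
      if b + d + a = x then pcoeff g b * pcoeff h d * pcoeff f a else 0)"
    by (rule key[OF g h f c])
  also have "\<dots> = (\<Sum>b\<in>?B. \<Sum>d\<in>?C. \<Sum>a\<in>?A.
      if a + b + d = x then pcoeff f a * pcoeff g b * pcoeff h d else 0)"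
    by (intro sum.cong refl) (auto simp: ac_simps)
  also have "\<dots> = (\<Sum>a\<in>?A. \<Sum>b\<in>?B. \<Sum>d\<in>?C.
      if a + b + d = x then pcoeff f a * pcoeff g b * pcoeff h d else 0)"
    by (rule sum_rotate3)
  also have "\<dots> = pcoeff (f * g * h) x"
    by (rule key[OF f g h c, symmetric])
  finally show "pcoeff (f * g * h) x = pcoeff (f * (g * h)) x" by simp
qed

lemma puiseux_distrib: "(f + g) * h = f * h + g * h" for f g h :: puiseux
proof (rule puiseux_eqI)
  fix x
  obtain M where M: "\<And>a. pcoeff h a \<noteq> 0 \<Longrightarrow> a \<le> M" using pcoeff_bdd[of h] by blast
  obtain M1 where M1: "\<And>a. pcoeff f a \<noteq> 0 \<Longrightarrow> a \<le> M1" using pcoeff_bdd[of f] by blast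
  obtain M2 where M2: "\<And>a. pcoeff g a \<noteq> 0 \<Longrightarrow> a \<le> M2" using pcoeff_bdd[of g] by blast
  let ?A = "{a. pcoeff f a \<noteq> 0 \<and> x - M \<le> a} \<union> {a. pcoeff g a \<noteq> 0 \<and> x - M \<le> a}"
  let ?B = "{b. pcoeff h b \<noteq> 0 \<and> x - max M1 M2 \<le> b}"
  have A: "finite ?A" and B: "finite ?B" using pcoeff_finite by auto
  have add: "pcoeff (f + g) a = pcoeff f a + pcoeff g a" for a by transfer simp
  have mem: "a \<in> ?A \<and> b \<in> ?B"
    if "pcoeff f a \<noteq> 0 \<or> pcoeff g a \<noteq> 0" "pcoeff h b \<noteq> 0" "a + b = x" for a b
    using that M[of b] M1[of a] M2[of a] by auto
  have 1: "pcoeff ((f + g) * h) x =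
      (\<Sum>a\<in>?A. \<Sum>b\<in>?B. if a + b = x then pcoeff (f + g) a * pcoeff h b else 0)"
    by (rule pcoeff_mult_double_sum[OF A B], rule mem) (auto simp: add)
  have 2: "pcoeff (f * h) x =
      (\<Sum>a\<in>?A. \<Sum>b\<in>?B. if a + b = x then pcoeff f a * pcoeff h b else 0)"
    by (rule pcoeff_mult_double_sum[OF A B], rule mem) auto
  have 3: "pcoeff (g * h) x =
      (\<Sum>a\<in>?A. \<Sum>b\<in>?B. if a + b = x then pcoeff g a * pcoeff h b else 0)"
    by (rule pcoeff_mult_double_sum[OF A B], rule mem) auto
  have "pcoeff (f * h + g * h) x = pcoeff (f * h) x + pcoeff (g * h) x" by transfer simp
  then show "pcoeff ((f + g) * h) x = pcoeff (f * h + g * h) x"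
    unfolding 1 2 3 sum.distrib[symmetric] by (auto simp: add algebra_simps intro!: sum.cong)
qed

lemma puiseux_one_mult: "1 * f = f" for f :: puiseux
proof (rule puiseux_eqI)
  fix x
  have one: "pcoeff 1 a = (if a = 0 then 1 else 0)" for a by transfer simp
  have "pcoeff (1 * f) x =
      (\<Sum>a\<in>{0}. \<Sum>b\<in>{x}. if a + b = x then pcoeff 1 a * pcoeff f b else 0)"
    by (rule pcoeff_mult_double_sum) (auto simp: one split: if_splits)
  then show "pcoeff (1 * f) x = pcoeff f x" by (simp add: one)
qed

instance
proof
  fix a b c :: puiseux
  show "a + b + c = a + (b + c)" by transfer (simp add: add.assoc)
  show "a + b = b + a" by transfer (simp add: add.commute)
  show "0 + a = a" by transfer simp
  show "- a + a = 0" by transfer simp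
  show "a - b = a + - b" by transfer simp
  show "a * b * c = a * (b * c)" by (rule puiseux_mult_assoc)
  show "a * b = b * a" by (rule puiseux_mult_commute)
  show "1 * a = a" by (rule puiseux_one_mult)
  show "(a + b) * c = a * c + b * c" by (rule puiseux_distrib)
  have "pcoeff 0 0 = 0" "pcoeff 1 0 = 1" by (transfer, simp)+
  then show "(0 :: puiseux) \<noteq> 1" by auto
qed

end

lemma pcoeff_simps [simp]:
  "pcoeff 0 x = 0"
  "pcoeff 1 x = (if x = 0 then 1 else 0)"
  "pcoeff (f + g) x = pcoeff f x + pcoeff g x"
  "pcoeff (- f) x = - pcoeff f x"
  "pcoeff (f - g) x = pcoeff f x - pcoeff g x"
  by (transfer, simp)+

lemma pcoeff_sum: "pcoeff (sum f A) x = (\<Sum>i\<in>A. pcoeff (f i) x)"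
  by (induction A rule: infinite_finite_induct) auto

lemma pcoeff_nonzero_ex: "f \<noteq> 0 \<Longrightarrow> \<exists>x. pcoeff f x \<noteq> 0"
  using puiseux_eqI[of f 0] by auto

lemma pcoeff_top_ex:
  assumes "f \<noteq> 0"
  shows "\<exists>e. pcoeff f e \<noteq> 0 \<and> (\<forall>x. pcoeff f x \<noteq> 0 \<longrightarrow> x \<le> e)"
proof -
  obtain x0 where x0: "pcoeff f x0 \<noteq> 0" using pcoeff_nonzero_ex[OF assms] by blast
  let ?S = "{x. pcoeff f x \<noteq> 0 \<and> x0 \<le> x}"
  have S: "finite ?S" "?S \<noteq> {}" using pcoeff_finite x0 by auto
  have "x \<le> Max ?S" if "pcoeff f x \<noteq> 0" for x
  proof (cases "x0 \<le> x")
    case True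
    then show ?thesis using that S by (intro Max_ge) auto
  next
    case False
    then show ?thesis using Max_ge[OF S(1), of x0] x0 by auto
  qed
  then show ?thesis using Max_in[OF S] by auto
qed

definition lead_exp :: "puiseux \<Rightarrow> real" where
  "lead_exp f = (GREATEST x. pcoeff f x \<noteq> 0)"

definition puiseux_lead_coeff :: "puiseux \<Rightarrow> real" where
  "puiseux_lead_coeff f = pcoeff f (lead_exp f)"

definition pval :: "puiseux \<Rightarrow> ereal" where
  "pval f = (if f = 0 then - \<infinity> else ereal (lead_exp f))"

lemma lead_expI:
  assumes "pcoeff f e \<noteq> 0" "\<And>x. pcoeff f x \<noteq> 0 \<Longrightarrow> x \<le> e"
  shows "lead_exp f = e"
  unfolding lead_exp_def by (rule Greatest_equality) (use assms in auto)

lemma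
  assumes "f \<noteq> 0"
  shows puiseux_lead_coeff_nonzero: "puiseux_lead_coeff f \<noteq> 0"
    and pcoeff_le_lead_exp: "pcoeff f x \<noteq> 0 \<Longrightarrow> x \<le> lead_exp f"
proof -
  obtain e where e: "pcoeff f e \<noteq> 0" "\<And>x. pcoeff f x \<noteq> 0 \<Longrightarrow> x \<le> e"
    using pcoeff_top_ex[OF assms] by blast
  have "lead_exp f = e" by (rule lead_expI[OF e])
  then show "puiseux_lead_coeff f \<noteq> 0" "pcoeff f x \<noteq> 0 \<Longrightarrow> x \<le> lead_exp f"
    using e by (auto simp: puiseux_lead_coeff_def)
qed

lemma
  assumes "f \<noteq> 0" "g \<noteq> 0"
  shows puiseux_mult_nonzero: "f * g \<noteq> 0"
    and lead_exp_mult: "lead_exp (f * g) = lead_exp f + lead_exp g"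
    and puiseux_lead_coeff_mult:
      "puiseux_lead_coeff (f * g) = puiseux_lead_coeff f * puiseux_lead_coeff g"
proof -
  let ?e = "lead_exp f" and ?d = "lead_exp g"
  have "pcoeff (f * g) (?e + ?d) = (\<Sum>a\<in>{?e}. \<Sum>b\<in>{?d}.
      if a + b = ?e + ?d then pcoeff f a * pcoeff g b else 0)"
  proof (rule pcoeff_mult_double_sum)
    fix a b assume "pcoeff f a \<noteq> 0" "pcoeff g b \<noteq> 0" "a + b = ?e + ?d"
    then show "a \<in> {?e} \<and> b \<in> {?d}"
      using pcoeff_le_lead_exp[OF assms(1), of a] pcoeff_le_lead_exp[OF assms(2), of b] by auto
  qed auto
  then have top: "pcoeff (f * g) (?e + ?d) = puiseux_lead_coeff f * puiseux_lead_coeff g"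
    by (simp add: puiseux_lead_coeff_def)
  then have nz: "pcoeff (f * g) (?e + ?d) \<noteq> 0"
    using assms puiseux_lead_coeff_nonzero by simp
  have "x \<le> ?e + ?d" if "pcoeff (f * g) x \<noteq> 0" for x
    using pcoeff_mult_nonzero[OF that] pcoeff_le_lead_exp[OF assms(1)]
      pcoeff_le_lead_exp[OF assms(2)] by (metis add_mono)
  then show exp: "lead_exp (f * g) = ?e + ?d" by (rule lead_expI[OF nz])
  show "f * g \<noteq> 0" using nz by auto
  show "puiseux_lead_coeff (f * g) = puiseux_lead_coeff f * puiseux_lead_coeff g"
    using top by (simp add: puiseux_lead_coeff_def exp)
qed

lemma puiseux_lead_coeff_add_pos:
  assumes f: "f \<noteq> 0" "0 < puiseux_lead_coeff f" and g: "g \<noteq> 0" "0 < puiseux_lead_coeff g"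
  shows "f + g \<noteq> 0 \<and> 0 < puiseux_lead_coeff (f + g)"
proof -
  let ?e = "max (lead_exp f) (lead_exp g)"
  have nn: "0 \<le> pcoeff h x" if "h \<noteq> 0" "0 < puiseux_lead_coeff h" "lead_exp h \<le> x" for h x
    using pcoeff_le_lead_exp[OF that(1), of x] that(2,3)
    by (cases "pcoeff h x = 0") (auto simp: puiseux_lead_coeff_def)
  have pos: "0 < pcoeff (f + g) ?e"
  proof (cases "lead_exp g \<le> lead_exp f")
    case True
    then show ?thesis using f nn[OF g, of ?e] by (simp add: puiseux_lead_coeff_def max_def)
  next
    case False
    then show ?thesis using g nn[OF f, of ?e] by (simp add: puiseux_lead_coeff_def max_def)
  qed
  have "x \<le> ?e" if "pcoeff (f + g) x \<noteq> 0" for x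
    using that pcoeff_le_lead_exp[OF f(1), of x] pcoeff_le_lead_exp[OF g(1), of x] by fastforce
  then have "lead_exp (f + g) = ?e" using pos by (intro lead_expI) auto
  then have "0 < puiseux_lead_coeff (f + g)" using pos by (simp add: puiseux_lead_coeff_def)
  moreover have "f + g \<noteq> 0" using pos by (metis less_irrefl pcoeff_simps(1))
  ultimately show ?thesis by simp
qed

lemma lead_exp_uminus: "lead_exp (- f) = lead_exp f"
  by (simp add: lead_exp_def)

lemma puiseux_lead_coeff_uminus: "puiseux_lead_coeff (- f) = - puiseux_lead_coeff f"
  by (simp add: puiseux_lead_coeff_def lead_exp_uminus)

subsection \<open>The ordered field structure\<close>

lemma puiseux_geometric_inverse:
  fixes h :: puiseux
  assumes d: "0 < d" and h: "\<And>x. pcoeff h x \<noteq> 0 \<Longrightarrow> x \<le> - d"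
  shows "\<exists>g. (1 - h) * g = 1"
proof -
  have pow: "x \<le> - (real k * d)" if "pcoeff (h ^ k) x \<noteq> 0" for k x
    using that
  proof (induction k arbitrary: x)
    case 0
    then show ?case by (simp split: if_splits)
  next
    case (Suc k)
    then have "pcoeff (h * h ^ k) x \<noteq> 0" by simp
    then obtain a b where "pcoeff h a \<noteq> 0" "pcoeff (h ^ k) b \<noteq> 0" "a + b = x"
      by (rule pcoeff_mult_nonzero)
    then have "x \<le> - d + - (real k * d)" using h Suc.IH by (metis add_mono)
    then show ?case by (simp add: algebra_simps)
  qed
  define N where "N x = nat \<lceil>- x / d\<rceil>" for x
  have N: "pcoeff (h ^ k) x = 0" if "N x < k" for k x
  proof (rule ccontr)
    assume "pcoeff (h ^ k) x \<noteq> 0"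
    then have "real k * d \<le> - x" using pow by fastforce
    then have "real k \<le> - x / d" using d by (simp add: field_simps)
    then show False using that unfolding N_def by linarith
  qed
  have N_mono: "N y \<le> N x" if "x \<le> y" for x y
    unfolding N_def using that d by (intro nat_mono ceiling_mono divide_right_mono) auto
  define G where "G x = (\<Sum>k\<le>N x. pcoeff (h ^ k) x)" for x
  have G: "G x = pcoeff (\<Sum>k\<le>n. h ^ k) x" if "N x \<le> n" for n x
    unfolding G_def pcoeff_sum
    by (rule sum.mono_neutral_left) (use that N in auto)
  have "puiseux_support {x. G x \<noteq> 0}"
  proof (rule puiseux_supportI)
    fix c
    show "finite {x. G x \<noteq> 0 \<and> c \<le> x}"
    proof (rule finite_subset[OF _ pcoeff_finite[of "\<Sum>k\<le>N c. h ^ k" c]])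
      show "{x. G x \<noteq> 0 \<and> c \<le> x} \<subseteq> {x. pcoeff (\<Sum>k\<le>N c. h ^ k) x \<noteq> 0 \<and> c \<le> x}"
        using G[OF N_mono] by auto
    qed
  qed
  then obtain g where g: "pcoeff g = G"
    by (metis Abs_puiseux_inverse mem_Collect_eq)
  have "(1 - h) * g = 1"
  proof (rule puiseux_eqI)
    fix x
    let ?s = "\<Sum>k\<le>N x. h ^ k"
    let ?r = "g - ?s"
    have "pcoeff ((1 - h) * ?r) x = 0"
    proof (rule ccontr)
      assume "pcoeff ((1 - h) * ?r) x \<noteq> 0"
      then obtain a b where a: "pcoeff (1 - h) a \<noteq> 0" and b: "pcoeff ?r b \<noteq> 0" and ab: "a + b = x"
        by (rule pcoeff_mult_nonzero)
      have "a \<le> 0" using a h[of a] d by (cases "a = 0") auto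
      then have "N b \<le> N x" using ab by (intro N_mono) auto
      then show False using b G[of b "N x"] g by simp
    qed
    moreover have "(1 - h) * g = (1 - h) * ?s + (1 - h) * ?r" by (simp add: algebra_simps)
    moreover have "(1 - h) * ?s = 1 - h ^ Suc (N x)" by (rule sum_gp_basic)
    ultimately show "pcoeff ((1 - h) * g) x = pcoeff 1 x"
      using N[of x "Suc (N x)"] by simp
  qed
  then show ?thesis by blast
qed

lift_definition pmonom :: "real \<Rightarrow> real \<Rightarrow> puiseux" is "\<lambda>c e x. if x = e then c else 0"
  by (simp add: puiseux_support_def)

lemma pcoeff_pmonom [simp]: "pcoeff (pmonom c e) x = (if x = e then c else 0)"
  by transfer simp

lemma pcoeff_pmonom_mult: "pcoeff (pmonom c e * f) x = c * pcoeff f (x - e)"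
proof -
  have "pcoeff (pmonom c e * f) x = (\<Sum>a\<in>{e}. \<Sum>b\<in>{x - e}.
      if a + b = x then pcoeff (pmonom c e) a * pcoeff f b else 0)"
    by (rule pcoeff_mult_double_sum) (auto split: if_splits)
  then show ?thesis by simp
qed

lemma puiseux_inverse_ex:
  fixes f :: puiseux
  assumes "f \<noteq> 0"
  shows "\<exists>g. f * g = 1"
proof -
  let ?m = "pmonom (1 / puiseux_lead_coeff f) (- lead_exp f)"
  define h where "h = 1 - ?m * f"
  have lc: "puiseux_lead_coeff f \<noteq> 0" by (rule puiseux_lead_coeff_nonzero[OF assms])
  have neg: "x < 0" if "pcoeff h x \<noteq> 0" for x
  proof -
    have "x \<noteq> 0" using that lc
      by (auto simp: h_def pcoeff_pmonom_mult puiseux_lead_coeff_def)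
    moreover from this that have "pcoeff f (x + lead_exp f) \<noteq> 0"
      by (auto simp: h_def pcoeff_pmonom_mult)
    ultimately show ?thesis using pcoeff_le_lead_exp[OF assms] by fastforce
  qed
  obtain d where d: "0 < d" "\<And>x. pcoeff h x \<noteq> 0 \<Longrightarrow> x \<le> - d"
  proof (cases "h = 0")
    case True
    then show ?thesis using that[of 1] by simp
  next
    case False
    then show ?thesis
      using that[of "- lead_exp h"] pcoeff_le_lead_exp[OF False] neg[of "lead_exp h"]
        puiseux_lead_coeff_nonzero[OF False] by (simp add: puiseux_lead_coeff_def)
  qed
  obtain g where "(1 - h) * g = 1" using puiseux_geometric_inverse[OF d] by blast
  then have "f * (?m * g) = 1" by (simp add: h_def ac_simps)
  then show ?thesis by blast
qed

instantiation puiseux :: linordered_field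
begin

definition less_puiseux :: "puiseux \<Rightarrow> puiseux \<Rightarrow> bool" where
  "f < g \<longleftrightarrow> g - f \<noteq> 0 \<and> 0 < puiseux_lead_coeff (g - f)"

definition less_eq_puiseux :: "puiseux \<Rightarrow> puiseux \<Rightarrow> bool" where
  "f \<le> g \<longleftrightarrow> f < g \<or> f = g" for f g :: puiseux

definition abs_puiseux :: "puiseux \<Rightarrow> puiseux" where
  "\<bar>f\<bar> = (if f < 0 then - f else f)" for f :: puiseux

definition sgn_puiseux :: "puiseux \<Rightarrow> puiseux" where
  "sgn f = (if f = 0 then 0 else if 0 < f then 1 else - 1)" for f :: puiseux

definition inverse_puiseux :: "puiseux \<Rightarrow> puiseux" where
  "inverse f = (if f = 0 then 0 else SOME g. f * g = 1)" for f :: puiseux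

definition divide_puiseux :: "puiseux \<Rightarrow> puiseux \<Rightarrow> puiseux" where
  "f div g = f * inverse g" for f g :: puiseux

instance
proof
  fix a b c :: puiseux
  have asym: "\<not> b < a" if "a < b" for a b :: puiseux
    using that puiseux_lead_coeff_uminus[of "b - a"] by (auto simp: less_puiseux_def)
  have trans: "a < c" if "a < b" "b < c" for a b c :: puiseux
    using puiseux_lead_coeff_add_pos[of "b - a" "c - b"] that by (simp add: less_puiseux_def)
  have total: "a < b \<or> a = b \<or> b < a" for a b :: puiseux
    using puiseux_lead_coeff_uminus[of "b - a"] puiseux_lead_coeff_nonzero[of "b - a"]
    by (auto simp: less_puiseux_def)
  show "a < b \<longleftrightarrow> a \<le> b \<and> \<not> b \<le> a" unfolding less_eq_puiseux_def using asym by metis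
  show "a \<le> a" by (simp add: less_eq_puiseux_def)
  show "a \<le> b \<Longrightarrow> b \<le> c \<Longrightarrow> a \<le> c" using trans by (auto simp: less_eq_puiseux_def)
  show "a \<le> b \<Longrightarrow> b \<le> a \<Longrightarrow> a = b" using asym by (auto simp: less_eq_puiseux_def)
  show "a \<le> b \<or> b \<le> a" using total by (auto simp: less_eq_puiseux_def)
  show "a \<le> b \<Longrightarrow> c + a \<le> c + b" by (auto simp: less_eq_puiseux_def less_puiseux_def)
  show "a < b \<Longrightarrow> 0 < c \<Longrightarrow> c * a < c * b"
    using puiseux_lead_coeff_mult[of c "b - a"] puiseux_mult_nonzero[of c "b - a"]
    by (auto simp: less_puiseux_def right_diff_distrib)
  show "\<bar>a\<bar> = (if a < 0 then - a else a)" by (simp add: abs_puiseux_def)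
  show "sgn a = (if a = 0 then 0 else if 0 < a then 1 else - 1)" by (simp add: sgn_puiseux_def)
  show "inverse a * a = 1" if "a \<noteq> 0"
    using someI_ex[OF puiseux_inverse_ex[OF that]] that
    by (simp add: inverse_puiseux_def mult.commute)
  show "a div b = a * inverse b" by (simp add: divide_puiseux_def)
  show "inverse (0 :: puiseux) = 0" by (simp add: inverse_puiseux_def)
qed

end

lemma puiseux_pos_iff: "0 < f \<longleftrightarrow> f \<noteq> 0 \<and> 0 < puiseux_lead_coeff f" for f :: puiseux
  by (simp add: less_puiseux_def)

section \<open>Minors and total positivity\<close>

definition square_submatrices :: "'a mat \<Rightarrow> 'a mat set" where
  "square_submatrices A = {submatrix A I J | I J.
     I \<subseteq> {0..<dim_row A} \<and> J \<subseteq> {0..<dim_col A} \<and> card I = card J \<and> I \<noteq> {}}"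

definition TP :: "nat \<Rightarrow> nat \<Rightarrow> puiseux mat set" where
  "TP n m = {A \<in> carrier_mat n m. \<forall>B\<in>square_submatrices A. det B > 0}"

definition TN :: "nat \<Rightarrow> nat \<Rightarrow> puiseux mat set" where
  "TN n m = {A \<in> carrier_mat n m. \<forall>B\<in>square_submatrices A. det B \<ge> 0}"

definition TN_nonzero :: "nat \<Rightarrow> nat \<Rightarrow> puiseux mat set" where
  "TN_nonzero n m = {A \<in> TN n m. \<forall>i<n. \<forall>j<m. A $$ (i, j) \<noteq> 0}"

definition val_set :: "puiseux mat set \<Rightarrow> ereal mat set" where
  "val_set S = map_mat pval ` S"

section \<open>Tropical minors\<close>

text \<open>Tropical matrices have entries in the reals extended by minus infinity. They are represented
  over \<^typ>\<open>ereal\<close>; the value plus infinity is never taken by the matrices considered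
  below. The tropical notions are applied to square matrices only.\<close>

definition trop_weight :: "ereal mat \<Rightarrow> (nat \<Rightarrow> nat) \<Rightarrow> ereal" where
  "trop_weight M \<sigma> = (\<Sum>i = 0..<dim_row M. M $$ (i, \<sigma> i))"

definition trop_per :: "ereal mat \<Rightarrow> ereal" where
  "trop_per M = Max (trop_weight M ` {\<sigma>. \<sigma> permutes {0..<dim_row M}})"

definition max_weight_perms :: "ereal mat \<Rightarrow> (nat \<Rightarrow> nat) set" where
  "max_weight_perms M = {\<sigma>. \<sigma> permutes {0..<dim_row M} \<and> trop_weight M \<sigma> = trop_per M}"

definition sign_nonsingular :: "ereal mat \<Rightarrow> bool" where
  "sign_nonsingular M \<longleftrightarrow> trop_per M \<noteq> - \<infinity> \<and>
     (\<forall>\<sigma>\<in>max_weight_perms M. \<forall>\<tau>\<in>max_weight_perms M. evenperm \<sigma> = evenperm \<tau>)"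

definition trop_positive :: "ereal mat \<Rightarrow> bool" where
  "trop_positive M \<longleftrightarrow> sign_nonsingular M \<and> (\<forall>\<sigma>\<in>max_weight_perms M. evenperm \<sigma>)"

definition trop_nonneg :: "ereal mat \<Rightarrow> bool" where
  "trop_nonneg M \<longleftrightarrow> trop_positive M \<or> \<not> sign_nonsingular M"

definition real_mats :: "nat \<Rightarrow> nat \<Rightarrow> ereal mat set" where
  "real_mats n m = {A \<in> carrier_mat n m. \<forall>i<n. \<forall>j<m. A $$ (i, j) \<in> range ereal}"

definition TN_trop :: "nat \<Rightarrow> nat \<Rightarrow> ereal mat set" where
  "TN_trop n m = {A \<in> real_mats n m. \<forall>B\<in>square_submatrices A. trop_nonneg B}"

definition TN_trop2 :: "nat \<Rightarrow> nat \<Rightarrow> ereal mat set" where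
  "TN_trop2 n m =
     {A \<in> real_mats n m. \<forall>B\<in>square_submatrices A. dim_row B \<le> 2 \<longrightarrow> trop_nonneg B}"

end

theory Submission
  imports Defs
begin

text \<open>
  The four sets are shown equal by going around the circle
  \<open>TN_trop \<subseteq> TN_trop2 \<subseteq> val TP \<subseteq> val TN_nonzero \<subseteq> TN_trop\<close>.
  The first and third inclusions are immediate. The other two have a common source, an inequality
  valid in every ordered integral domain. Suppose that a matrix \<open>M\<close> with positive
  entries satisfies \<open>q * M(i,j') * M(i',j) \<le> M(i,j) * M(i',j')\<close> for all \<open>i < i'\<close>, \<open>j < j'\<close>, where
  \<open>q \<ge> 1\<close>. Uncrossing the inversions of a permutation one by one turns it into the identity without
  decreasing the product of the chosen entries, and the first uncrossing gains a factor \<open>q\<close>. So in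
  every square submatrix \<open>q\<close> times a nonidentity permutation product is at most the diagonal product
  (\<open>prod_permutation_le_diagonal\<close>).

  With \<open>q = 1\<close> this applies to the valuations: the two by two minors of a totally nonnegative matrix
  with nonzero entries give the hypothesis, and the conclusion says that in each square submatrix the
  identity has maximum tropical weight. Either all permutations of maximum weight then share its even
  parity, or the submatrix is sign-singular; both outcomes are tropically nonnegative
  (\<open>trop_nonneg_map_pval\<close>).

  With \<open>q \<ge> k!\<close> it shows that a \<open>k\<close> by \<open>k\<close> determinant is positive, because the at most \<open>k! - 1\<close>
  negative terms cannot compensate the diagonal one (\<open>det_pos_if_two_minors_dominate\<close>). A real matrix
  \<open>a\<close> with tropically nonnegative minors of size at most two satisfies the Monge inequalities
  \<open>a(i,j') + a(i',j) \<le> a(i,j) + a(i',j')\<close>, and is therefore lifted to a totally positive matrix by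
  \<open>M(i,j) = L^(i*j) t^(a(i,j))\<close> with \<open>L = n!\<close>: the exponents of \<open>t\<close> obey the Monge inequalities,
  and the exponents of \<open>L\<close> obey them strictly, which yields the factor \<open>q = L\<close>
  (\<open>TN_trop2_subset_val_TP\<close>).
\<close>

section \<open>Matrices whose two by two minors are dominated by the diagonal\<close>

text \<open>For \<open>q = 1\<close> the second condition is the nonnegativity of the two by two minors; larger \<open>q\<close> make
  it quantitative.\<close>

definition two_minors_dominate :: "'a :: linordered_idom \<Rightarrow> 'a mat \<Rightarrow> bool" where
  "two_minors_dominate q A \<longleftrightarrow>
     (\<forall>i<dim_row A. \<forall>j<dim_col A. 0 < A $$ (i, j)) \<and>
     (\<forall>i i' j j'. i < i' \<longrightarrow> i' < dim_row A \<longrightarrow> j < j' \<longrightarrow> j' < dim_col A \<longrightarrow>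
        q * (A $$ (i, j') * A $$ (i', j)) \<le> A $$ (i, j) * A $$ (i', j'))"

text \<open>Induction on the size. If the permutation moves the last index \<open>k\<close>, its two entries in
  row \<open>k\<close> and column \<open>k\<close> cross; exchanging their columns gains the factor \<open>q\<close> and produces a
  permutation fixing \<open>k\<close>, which is a permutation of the smaller size. Only one factor \<open>q\<close> is
  kept, whatever the number of further exchanges.\<close>

lemma prod_permutation_le_diagonal:
  fixes M :: "nat \<Rightarrow> nat \<Rightarrow> 'a :: linordered_idom"
  assumes q: "1 \<le> q"
    and "\<And>i j. i < k \<Longrightarrow> j < k \<Longrightarrow> 0 < M i j"
    and "\<And>i i' j j'. i < i' \<Longrightarrow> i' < k \<Longrightarrow> j < j' \<Longrightarrow> j' < k \<Longrightarrow>
       q * (M i j' * M i' j) \<le> M i j * M i' j'"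
    and "\<sigma> permutes {0..<k}" and "\<sigma> \<noteq> id"
  shows "q * (\<Prod>i = 0..<k. M i (\<sigma> i)) \<le> (\<Prod>i = 0..<k. M i i)"
  using assms(2-5)
proof (induction k arbitrary: \<sigma>)
  case 0
  then show ?case by simp
next
  case (Suc k)
  have IH: "q * (\<Prod>i = 0..<k. M i (\<tau> i)) \<le> (\<Prod>i = 0..<k. M i i)"
    if "\<tau> permutes {0..<k}" "\<tau> \<noteq> id" for \<tau>
    using Suc.prems(1,2) that by (intro Suc.IH) auto
  have range: "\<tau> i < k" if "\<tau> permutes {0..<k}" "i < k" for \<tau> i
    using permutes_in_image[OF that(1), of i] that(2) by simp
  have restrict: "\<tau> permutes {0..<k}" if "\<tau> permutes {0..<Suc k}" "\<tau> k = k" for \<tau>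
    by (rule permutes_superset[OF that(1)]) (use that(2) in auto)
  have pos_prod: "0 < (\<Prod>i = 0..<k. M i (\<tau> i))" if "\<tau> permutes {0..<k}" for \<tau>
    using range[OF that] Suc.prems(1) by (intro prod_pos) (auto simp: less_Suc_eq)
  have Mkk: "0 < M k k" using Suc.prems(1) by simp
  show ?case
  proof (cases "\<sigma> k = k")
    case True
    have "q * (\<Prod>i = 0..<k. M i (\<sigma> i)) \<le> (\<Prod>i = 0..<k. M i i)"
      by (rule IH[OF restrict[OF Suc.prems(3) True] Suc.prems(4)])
    from mult_right_mono[OF this less_imp_le[OF Mkk]] True show ?thesis
      by (simp add: mult.assoc)
  next
    case False
    obtain p where \<sigma>p: "\<sigma> p = k" using permutes_surj[OF Suc.prems(3)] by (metis surjD)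
    define j where "j = \<sigma> k"
    \<comment> \<open>Uncrossing the entries at \<open>(p, k)\<close> and \<open>(k, j)\<close> into \<open>(p, j)\<close> and \<open>(k, k)\<close>.\<close>
    define \<tau> where "\<tau> = \<sigma> \<circ> transpose p k"
    have "p \<in> {0..<Suc k}" "j \<in> {0..<Suc k}"
      using permutes_in_image[OF Suc.prems(3)] \<sigma>p by (auto simp: j_def)
    then have p: "p < k" and j: "j < k"
      using False \<sigma>p by (auto simp: j_def less_Suc_eq)
    have "\<tau> permutes {0..<Suc k}"
      unfolding \<tau>_def using Suc.prems(3) p
      by (intro permutes_compose[OF permutes_swap_id]) auto
    moreover have \<tau>k: "\<tau> k = k" by (simp add: \<tau>_def \<sigma>p)
    ultimately have \<tau>: "\<tau> permutes {0..<k}" by (rule restrict)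
    define R where "R = (\<Prod>i\<in>{0..<k} - {p}. M i (\<sigma> i))"
    have R_\<tau>: "R = (\<Prod>i\<in>{0..<k} - {p}. M i (\<tau> i))"
      unfolding R_def \<tau>_def by (rule prod.cong) (auto simp: transpose_def)
    have split\<sigma>: "(\<Prod>i = 0..<Suc k. M i (\<sigma> i)) = M p k * M k j * R"
      using p by (simp add: R_def \<sigma>p j_def prod.remove[of "{0..<k}" p] ac_simps)
    have split\<tau>: "(\<Prod>i = 0..<k. M i (\<tau> i)) = M p j * R"
      unfolding R_\<tau> using p by (simp add: prod.remove[of "{0..<k}" p] \<tau>_def j_def)
    have "0 < M p j * R" using pos_prod[OF \<tau>] split\<tau> by simp
    moreover have "0 < M p j" using Suc.prems(1) p j by simp
    ultimately have "0 \<le> R" by (simp add: zero_less_mult_iff)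
    have "q * (M p k * M k j) \<le> M p j * M k k"
      using Suc.prems(2)[of p k j k] p j by simp
    then have "q * (\<Prod>i = 0..<Suc k. M i (\<sigma> i)) \<le> M p j * M k k * R"
      unfolding split\<sigma> using \<open>0 \<le> R\<close> by (metis mult.assoc mult_right_mono)
    also have "\<dots> = (\<Prod>i = 0..<k. M i (\<tau> i)) * M k k"
      by (simp add: split\<tau> ac_simps)
    also have "\<dots> \<le> (\<Prod>i = 0..<k. M i i) * M k k"
    proof (rule mult_right_mono)
      show "(\<Prod>i = 0..<k. M i (\<tau> i)) \<le> (\<Prod>i = 0..<k. M i i)"
      proof (cases "\<tau> = id")
        case False
        have "1 * (\<Prod>i = 0..<k. M i (\<tau> i)) \<le> q * (\<Prod>i = 0..<k. M i (\<tau> i))"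
          using q pos_prod[OF \<tau>] by (intro mult_right_mono) auto
        then show ?thesis using IH[OF \<tau> False] by simp
      qed simp
    qed (use Mkk in simp)
    finally show ?thesis by simp
  qed
qed

lemma two_minors_dominate_prod_le:
  fixes A :: "'a :: linordered_idom mat"
  assumes "two_minors_dominate q A" "1 \<le> q" "A \<in> carrier_mat k k"
    and "\<sigma> permutes {0..<k}" "\<sigma> \<noteq> id"
  shows "q * (\<Prod>i = 0..<k. A $$ (i, \<sigma> i)) \<le> (\<Prod>i = 0..<k. A $$ (i, i))"
  by (rule prod_permutation_le_diagonal[of q k "\<lambda>i j. A $$ (i, j)"])
    (use assms in \<open>auto simp: two_minors_dominate_def\<close>)

lemma det_pos_if_two_minors_dominate:
  fixes A :: "'a :: linordered_field mat"
  assumes dom: "two_minors_dominate q A" and A: "A \<in> carrier_mat k k" and q: "fact k \<le> q"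
  shows "0 < det A"
proof -
  let ?P = "{\<sigma>. \<sigma> permutes {0..<k}}"
  define D where "D = (\<Prod>i = 0..<k. A $$ (i, i))"
  define T where "T \<sigma> = (\<Prod>i = 0..<k. A $$ (i, \<sigma> i))" for \<sigma>
  have D: "0 < D"
    unfolding D_def using dom A by (intro prod_pos) (auto simp: two_minors_dominate_def)
  have q1: "1 \<le> q" using fact_ge_1[of k, where 'a = 'a] q by linarith
  have fin: "finite ?P" by (simp add: finite_permutations)
  have card: "card ?P = fact k" by (simp add: card_permutations)
  \<comment> \<open>Each of the \<open>k! - 1\<close> nonidentity terms of the Leibniz expansion has absolute value at most
    \<open>D / q\<close>.\<close>
  have "- (D / q) \<le> signof \<sigma> * T \<sigma>" if "\<sigma> \<in> ?P - {id}" for \<sigma>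
  proof -
    have "\<sigma> permutes {0..<k}" "\<sigma> \<noteq> id" using that by auto
    then have "q * T \<sigma> \<le> D"
      unfolding T_def D_def using two_minors_dominate_prod_le[OF dom q1 A] by blast
    then have le: "T \<sigma> \<le> D / q" using q1 by (simp add: field_simps)
    have "\<sigma> i < k" if "i < k" for i
      using permutes_in_image[OF \<open>\<sigma> permutes {0..<k}\<close>, of i] that by simp
    then have "0 \<le> T \<sigma>"
      unfolding T_def using dom A
      by (intro prod_nonneg) (auto simp: two_minors_dominate_def intro!: less_imp_le)
    moreover have "0 \<le> D / q" using D q1 by simp
    ultimately have "- (D / q) \<le> T \<sigma>" by linarith
    with le show ?thesis by (cases "evenperm \<sigma>") (auto simp: sign_def)
  qed
  then have "(\<Sum>\<sigma>\<in>?P - {id}. - (D / q)) \<le> (\<Sum>\<sigma>\<in>?P - {id}. signof \<sigma> * T \<sigma>)"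
    by (rule sum_mono)
  moreover have "(\<Sum>\<sigma>\<in>?P - {id}. - (D / q)) = - ((fact k - 1) * (D / q))"
    using card fin by (simp add: card_Diff_singleton permutes_id of_nat_diff)
  moreover have "det A = T id + (\<Sum>\<sigma>\<in>?P - {id}. signof \<sigma> * T \<sigma>)"
    unfolding det_def'[OF A] T_def[symmetric]
    by (subst sum.remove[OF fin, of id]) (auto simp: permutes_id sign_id)
  moreover have "(fact k - 1) * (D / q) < D"
  proof -
    have "(fact k - 1) * D < q * D" using q D by (intro mult_strict_right_mono) auto
    then show ?thesis using q1 by (simp add: field_simps)
  qed
  moreover have "T id = D" by (simp add: T_def D_def)
  ultimately show ?thesis by linarith
qed

section \<open>Submatrices\<close>

lemma submatrix_carrier:
  assumes "I \<subseteq> {0..<dim_row A}" "J \<subseteq> {0..<dim_col A}"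
  shows "submatrix A I J \<in> carrier_mat (card I) (card J)"
proof -
  have "{i. i < dim_row A \<and> i \<in> I} = I" "{j. j < dim_col A \<and> j \<in> J} = J" using assms by auto
  then show ?thesis by (intro carrier_matI) (simp_all add: dim_submatrix)
qed

lemma submatrix_index_pick:
  assumes "I \<subseteq> {0..<dim_row A}" "J \<subseteq> {0..<dim_col A}" "i < card I" "j < card J"
  shows "submatrix A I J $$ (i, j) = A $$ (pick I i, pick J j)"
    and "pick I i < dim_row A" and "pick J j < dim_col A"
proof -
  have "{i. i < dim_row A \<and> i \<in> I} = I" "{j. j < dim_col A \<and> j \<in> J} = J" using assms(1,2) by auto
  then show "submatrix A I J $$ (i, j) = A $$ (pick I i, pick J j)"
    using assms(3,4) by (intro submatrix_index) simp_all
  show "pick I i < dim_row A" "pick J j < dim_col A"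
    using pick_in_set_le[OF assms(3)] pick_in_set_le[OF assms(4)] assms(1,2) by auto
qed

lemma square_submatrices_carrier:
  assumes "B \<in> square_submatrices A"
  obtains k where "B \<in> carrier_mat k k" "k \<le> dim_row A"
proof -
  from assms obtain I J where IJ: "B = submatrix A I J" "I \<subseteq> {0..<dim_row A}"
    "J \<subseteq> {0..<dim_col A}" "card I = card J"
    unfolding square_submatrices_def by blast
  have "card I \<le> dim_row A" using card_mono[OF _ IJ(2)] by simp
  with that submatrix_carrier[OF IJ(2,3)] IJ(1,4) show ?thesis by simp
qed

lemma two_minors_dominate_submatrix:
  assumes dom: "two_minors_dominate q A" and B: "B \<in> square_submatrices A"
  shows "two_minors_dominate q B"
proof -
  obtain I J where IJ: "B = submatrix A I J" "I \<subseteq> {0..<dim_row A}" "J \<subseteq> {0..<dim_col A}"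
    using B unfolding square_submatrices_def by blast
  note carr = submatrix_carrier[OF IJ(2,3)] and index = submatrix_index_pick[OF IJ(2,3)]
  show ?thesis
    unfolding two_minors_dominate_def IJ(1)
  proof (intro conjI allI impI)
    fix i j assume "i < dim_row (submatrix A I J)" "j < dim_col (submatrix A I J)"
    then show "0 < submatrix A I J $$ (i, j)"
      using dom carr index[of i j] by (simp add: two_minors_dominate_def)
  next
    fix i i' j j'
    assume "i < i'" "i' < dim_row (submatrix A I J)" "j < j'" "j' < dim_col (submatrix A I J)"
    then have ij: "i < i'" "i' < card I" "j < j'" "j' < card J" using carr by simp_all
    have "pick I i < pick I i'" "pick J j < pick J j'" using ij by (simp_all add: pick_mono_le)
    then show "q * (submatrix A I J $$ (i, j') * submatrix A I J $$ (i', j))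
        \<le> submatrix A I J $$ (i, j) * submatrix A I J $$ (i', j')"
      using dom ij index[of i' j'] index[of i j] index[of i j'] index[of i' j]
      by (simp add: two_minors_dominate_def)
  qed
qed

lemma square_submatrices_map_mat:
  "square_submatrices (map_mat f A) = map_mat f ` square_submatrices A"
proof -
  have submatrix: "submatrix (map_mat f A) I J = map_mat f (submatrix A I J)"
    if "I \<subseteq> {0..<dim_row A}" "J \<subseteq> {0..<dim_col A}" for I J
    using that submatrix_carrier[of I A J] submatrix_carrier[of I "map_mat f A" J]
    by (intro eq_matI) (simp_all add: submatrix_index_pick)
  show ?thesis
  proof (intro equalityI subsetI)
    fix B assume "B \<in> square_submatrices (map_mat f A)"
    then obtain I J where "I \<subseteq> {0..<dim_row A}" "J \<subseteq> {0..<dim_col A}" "card I = card J"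
      "I \<noteq> {}" "B = map_mat f (submatrix A I J)"
      unfolding square_submatrices_def using submatrix by auto
    then show "B \<in> map_mat f ` square_submatrices A"
      unfolding square_submatrices_def by blast
  next
    fix B assume "B \<in> map_mat f ` square_submatrices A"
    then obtain I J where IJ: "I \<subseteq> {0..<dim_row A}" "J \<subseteq> {0..<dim_col A}" "card I = card J"
      "I \<noteq> {}" and B: "B = submatrix (map_mat f A) I J"
      unfolding square_submatrices_def using submatrix by auto
    from IJ show "B \<in> square_submatrices (map_mat f A)"
      unfolding square_submatrices_def B by auto
  qed
qed

lemma entry_square_submatrix:
  assumes "i < dim_row A" "j < dim_col A"
  obtains B where "B \<in> square_submatrices A" "B \<in> carrier_mat 1 1" "B $$ (0, 0) = A $$ (i, j)"
proof (rule that[of "submatrix A {i} {j}"])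
  show "submatrix A {i} {j} \<in> square_submatrices A"
    unfolding square_submatrices_def mem_Collect_eq
    by (intro exI[of _ "{i}"] exI[of _ "{j}"]) (use assms in auto)
  show "submatrix A {i} {j} \<in> carrier_mat 1 1"
    using submatrix_carrier[of "{i}" A "{j}"] assms by simp
  show "submatrix A {i} {j} $$ (0, 0) = A $$ (i, j)"
  proof -
    have empty: "{a \<in> {x}. a < x} = {}" for x :: nat by auto
    show ?thesis
      using submatrix_index_card[OF assms, of "{i}" "{j}", unfolded empty] by simp
  qed
qed

lemma two_by_two_square_submatrix:
  assumes "i < i'" "i' < dim_row A" "j < j'" "j' < dim_col A"
  obtains B where "B \<in> square_submatrices A" "B \<in> carrier_mat 2 2"
    "B $$ (0, 0) = A $$ (i, j)" "B $$ (0, 1) = A $$ (i, j')"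
    "B $$ (1, 0) = A $$ (i', j)" "B $$ (1, 1) = A $$ (i', j')"
proof (rule that[of "submatrix A {i, i'} {j, j'}"])
  have ranks: "{a \<in> {i, i'}. a < i} = {}" "{a \<in> {i, i'}. a < i'} = {i}"
    "{a \<in> {j, j'}. a < j} = {}" "{a \<in> {j, j'}. a < j'} = {j}"
    using assms by auto
  note index = submatrix_index_card[of _ A _ "{i, i'}" "{j, j'}"]
  show "submatrix A {i, i'} {j, j'} \<in> square_submatrices A"
    unfolding square_submatrices_def mem_Collect_eq
    by (intro exI[of _ "{i, i'}"] exI[of _ "{j, j'}"]) (use assms in auto)
  show "submatrix A {i, i'} {j, j'} \<in> carrier_mat 2 2"
    using submatrix_carrier[of "{i, i'}" A "{j, j'}"] assms by (simp add: numeral_2_eq_2)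
  show "submatrix A {i, i'} {j, j'} $$ (0, 0) = A $$ (i, j)"
    "submatrix A {i, i'} {j, j'} $$ (0, 1) = A $$ (i, j')"
    "submatrix A {i, i'} {j, j'} $$ (1, 0) = A $$ (i', j)"
    "submatrix A {i, i'} {j, j'} $$ (1, 1) = A $$ (i', j')"
    using index[of i j, unfolded ranks] index[of i j', unfolded ranks]
      index[of i' j, unfolded ranks] index[of i' j', unfolded ranks] assms
    by simp_all
qed

lemma permutes_two: "{\<sigma>. \<sigma> permutes {0..<2 :: nat}} = {id, transpose 0 1}"
proof (intro equalityI subsetI)
  fix \<sigma> assume "\<sigma> \<in> {\<sigma>. \<sigma> permutes {0..<2 :: nat}}"
  then have \<sigma>: "\<sigma> permutes {0..<2}" by simp
  have "\<sigma> 0 < 2" "\<sigma> 1 < 2"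
    using permutes_in_image[OF \<sigma>, of 0] permutes_in_image[OF \<sigma>, of 1] by simp_all
  moreover have "\<sigma> 0 \<noteq> \<sigma> 1" using permutes_inj[OF \<sigma>] by (metis injD zero_neq_one)
  moreover have fixed: "\<sigma> x = x" if "x \<noteq> 0" "x \<noteq> 1" for x
    using permutes_not_in[OF \<sigma>, of x] that by simp
  ultimately consider "\<sigma> 0 = 0" "\<sigma> 1 = 1" | "\<sigma> 0 = 1" "\<sigma> 1 = 0" by linarith
  then show "\<sigma> \<in> {id, transpose 0 1}"
  proof cases
    case 1
    then have "\<sigma> x = id x" for x using fixed[of x] by (cases "x = 0 \<or> x = 1") auto
    then have "\<sigma> = id" by (rule ext)
    then show ?thesis by simp
  next
    case 2
    then have "\<sigma> x = transpose 0 1 x" for x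
      using fixed[of x] by (cases "x = 0 \<or> x = 1") (auto simp: transpose_def)
    then have "\<sigma> = transpose 0 1" by (rule ext)
    then show ?thesis by simp
  qed
qed (auto simp: permutes_id intro: permutes_swap_id)

lemma det_two_by_two:
  fixes A :: "'a :: comm_ring_1 mat"
  assumes "A \<in> carrier_mat 2 2"
  shows "det A = A $$ (0, 0) * A $$ (1, 1) - A $$ (0, 1) * A $$ (1, 0)"
proof -
  have "id \<noteq> transpose 0 (1 :: nat)" by (metis id_apply transpose_apply_first zero_neq_one)
  moreover have "sign (transpose 0 (1 :: nat)) = - 1" by (simp add: sign_swap_id)
  ultimately show ?thesis
    unfolding det_def'[OF assms] permutes_two by (simp add: numeral_2_eq_2 sign_id)
qed

section \<open>Valuation and order\<close>

lemma pval_mult: "pval (f * g) = pval f + pval g" if "f \<noteq> 0" "g \<noteq> 0"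
  using that by (simp add: pval_def lead_exp_mult)

lemma pval_one: "pval 1 = 0"
proof -
  have "lead_exp 1 = 0" by (rule lead_expI) (auto split: if_splits)
  then show ?thesis by (simp add: pval_def zero_ereal_def)
qed

lemma pval_prod: "(\<And>i. i \<in> S \<Longrightarrow> f i \<noteq> 0) \<Longrightarrow> pval (\<Prod>i\<in>S. f i) = (\<Sum>i\<in>S. pval (f i))"
proof (induction S rule: infinite_finite_induct)
  case (insert x S)
  then show ?case by (simp add: pval_mult)
qed (simp_all add: pval_one)

text \<open>If the leading exponent of \<open>f\<close> exceeded that of \<open>g\<close>, the leading term of \<open>g - f\<close> would be that of
  \<open>- f\<close>, which is negative.\<close>

lemma pval_mono:
  assumes "0 < f" "f \<le> g"
  shows "pval f \<le> pval g"
proof (rule ccontr)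
  assume "\<not> pval f \<le> pval g"
  moreover have f: "f \<noteq> 0" "0 < pcoeff f (lead_exp f)"
    using assms(1) by (auto simp: puiseux_pos_iff puiseux_lead_coeff_def)
  moreover have g: "g \<noteq> 0" using assms by auto
  ultimately have less: "lead_exp g < lead_exp f" by (simp add: pval_def)
  have g0: "pcoeff g x = 0" if "lead_exp f \<le> x" for x
    using pcoeff_le_lead_exp[OF g, of x] less that by force
  have "lead_exp (g - f) = lead_exp f"
    using f g0 pcoeff_le_lead_exp[OF f(1)] by (intro lead_expI) (force, metis g0 linear pcoeff_simps(5) diff_0 neg_equal_0_iff_equal)
  then have "puiseux_lead_coeff (g - f) < 0"
    using f g0 by (simp add: puiseux_lead_coeff_def)
  moreover have "f \<noteq> g" using less by auto
  ultimately show False using assms(2) by (simp add: less_eq_puiseux_def less_puiseux_def)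
qed

lemma lead_exp_pmonom: "c \<noteq> 0 \<Longrightarrow> lead_exp (pmonom c e) = e"
  by (rule lead_expI) (auto split: if_splits)

lemma pmonom_eq_0_iff: "pmonom c e = 0 \<longleftrightarrow> c = 0"
  by (metis pcoeff_pmonom pcoeff_simps(1) puiseux_eqI)

lemma pval_pmonom: "c \<noteq> 0 \<Longrightarrow> pval (pmonom c e) = ereal e"
  by (simp add: pval_def pmonom_eq_0_iff lead_exp_pmonom)

lemma pmonom_pos: "0 < c \<Longrightarrow> 0 < pmonom c e"
  by (simp add: puiseux_pos_iff puiseux_lead_coeff_def pmonom_eq_0_iff lead_exp_pmonom)

lemma pmonom_mult: "pmonom c e * pmonom d e' = pmonom (c * d) (e + e')"
  by (rule puiseux_eqI) (auto simp: pcoeff_pmonom_mult)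

lemma of_nat_eq_pmonom: "of_nat k = pmonom (of_nat k) 0"
proof (induction k)
  case 0
  then show ?case by (simp add: pmonom_eq_0_iff)
next
  case (Suc k)
  have "pmonom (of_nat (Suc k)) 0 = 1 + pmonom (of_nat k) 0" by (rule puiseux_eqI) simp
  with Suc show ?case by simp
qed

lemma pmonom_mono:
  assumes "0 < c" "c \<le> d" "e \<le> e'"
  shows "pmonom c e \<le> pmonom d e'"
proof (cases "pmonom c e = pmonom d e'")
  case False
  let ?h = "pmonom d e' - pmonom c e"
  have pos: "0 < pcoeff ?h e'" using False assms by (auto simp: order_le_less)
  have "x \<le> e'" if "pcoeff ?h x \<noteq> 0" for x using that assms by (auto split: if_splits)
  then have "lead_exp ?h = e'" using pos by (intro lead_expI) auto
  then show ?thesis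
    using pos False by (simp add: less_eq_puiseux_def less_puiseux_def puiseux_lead_coeff_def)
qed simp

section \<open>Tropical two by two minors and the identity permutation\<close>

text \<open>If the identity attains the maximum weight and all maximum-weight permutations have one parity,
  that parity is even.\<close>

lemma trop_nonnegI:
  assumes "B \<in> carrier_mat k k"
    and le: "\<And>\<sigma>. \<sigma> permutes {0..<k} \<Longrightarrow> trop_weight B \<sigma> \<le> trop_weight B id"
  shows "trop_nonneg B"
proof -
  have "trop_per B = trop_weight B id"
    unfolding trop_per_def
    using assms by (intro Max_eqI) (auto simp: finite_permutations permutes_id)
  then have "id \<in> max_weight_perms B" by (simp add: max_weight_perms_def permutes_id)
  then show ?thesis
    unfolding trop_nonneg_def trop_positive_def sign_nonsingular_def
    by (metis evenperm_id)
qed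

text \<open>Otherwise the transposition, which is odd, would be the only permutation of maximum weight.\<close>

lemma trop_nonneg_two_by_twoD:
  assumes B: "B \<in> carrier_mat 2 2"
    and real: "B $$ (0, 0) = ereal a" "B $$ (0, 1) = ereal b"
      "B $$ (1, 0) = ereal c" "B $$ (1, 1) = ereal d"
    and nonneg: "trop_nonneg B"
  shows "b + c \<le> a + d"
proof (rule ccontr)
  assume less: "\<not> b + c \<le> a + d"
  let ?s = "transpose 0 (1 :: nat)"
  have id: "trop_weight B id = ereal (a + d)" and s: "trop_weight B ?s = ereal (b + c)"
    using B real by (simp_all add: trop_weight_def numeral_2_eq_2)
  have perms: "{\<sigma>. \<sigma> permutes {0..<dim_row B}} = {id, ?s}"
    using B permutes_two by simp
  have per: "trop_per B = ereal (b + c)"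
    unfolding trop_per_def perms using less id s by (simp add: max_def)
  have "max_weight_perms B = {?s}"
  proof -
    have "max_weight_perms B = {\<sigma> \<in> {id, ?s}. trop_weight B \<sigma> = trop_per B}"
      unfolding max_weight_perms_def perms[symmetric] by simp
    then show ?thesis using less id s per by auto
  qed
  moreover have "\<not> evenperm ?s" by (simp add: evenperm_swap)
  ultimately show False
    using nonneg per by (simp add: trop_nonneg_def trop_positive_def sign_nonsingular_def)
qed

section \<open>The chain of inclusions\<close>

lemma TN_trop_subset_TN_trop2: "TN_trop n m \<subseteq> TN_trop2 n m"
  by (auto simp: TN_trop_def TN_trop2_def)

lemma TN_trop2_monge:
  assumes "A \<in> TN_trop2 n m" and a: "\<And>i j. i < n \<Longrightarrow> j < m \<Longrightarrow> A $$ (i, j) = ereal (a i j)"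
    and "i < i'" "i' < n" "j < j'" "j' < m"
  shows "a i j' + a i' j \<le> a i j + a i' j'"
proof -
  have A: "A \<in> carrier_mat n m" using assms(1) by (simp add: TN_trop2_def real_mats_def)
  obtain B where B: "B \<in> square_submatrices A" "B \<in> carrier_mat 2 2"
    "B $$ (0, 0) = A $$ (i, j)" "B $$ (0, 1) = A $$ (i, j')"
    "B $$ (1, 0) = A $$ (i', j)" "B $$ (1, 1) = A $$ (i', j')"
    using two_by_two_square_submatrix[of i i' A j j'] A assms(3-6) by auto
  have "trop_nonneg B" using assms(1) B(1,2) by (auto simp: TN_trop2_def)
  from trop_nonneg_two_by_twoD[OF B(2) _ _ _ _ this] show ?thesis
    using B(3-6) a assms(3-6) by simp
qed

text \<open>The lift is obtained from \<open>t^(a(i,j))\<close> by multiplying entrywise with the matrix \<open>L^(i*j)\<close>.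
  The real factors break the ties among permutations of equal tropical weight in favour of the
  identity, and \<open>L = n!\<close> is large enough for minors of every size \<open>k \<le> n\<close>.\<close>

lemma TN_trop2_subset_val_TP: "TN_trop2 n m \<subseteq> val_set (TP n m)"
proof
  fix A assume A: "A \<in> TN_trop2 n m"
  then have carr: "A \<in> carrier_mat n m" and "\<forall>i<n. \<forall>j<m. A $$ (i, j) \<in> range ereal"
    by (auto simp: TN_trop2_def real_mats_def)
  then have "\<forall>i j. \<exists>r. i < n \<longrightarrow> j < m \<longrightarrow> A $$ (i, j) = ereal r" by blast
  then obtain a where a: "\<And>i j. i < n \<Longrightarrow> j < m \<Longrightarrow> A $$ (i, j) = ereal (a i j)" by metis
  define L where "L = (fact n :: real)"
  have L: "1 \<le> L" by (simp add: L_def)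
  define M where "M = mat n m (\<lambda>(i, j). pmonom (L ^ (i * j)) (a i j))"
  have q: "(fact n :: puiseux) = pmonom L 0"
    using of_nat_eq_pmonom[of "fact n"] by (simp add: L_def)
  have "two_minors_dominate (fact n) M"
    unfolding two_minors_dominate_def
  proof (intro conjI allI impI)
    fix i j assume "i < dim_row M" "j < dim_col M"
    then show "0 < M $$ (i, j)" using L by (simp add: M_def pmonom_pos)
  next
    fix i i' j j'
    assume "i < i'" "i' < dim_row M" "j < j'" "j' < dim_col M"
    then have ij: "i < i'" "i' < n" "j < j'" "j' < m" by (simp_all add: M_def)
    \<comment> \<open>\<open>(i * j + i' * j') - (i * j' + i' * j) = (i' - i) * (j' - j) \<ge> 1\<close>.\<close>
    have exponent: "Suc (i * j' + i' * j) \<le> i * j + i' * j'"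
    proof -
      obtain s t where "i' = i + Suc s" "j' = j + Suc t"
        using ij less_imp_Suc_add by (metis add_Suc_right)
      then show ?thesis by (simp add: algebra_simps)
    qed
    have "fact n * (M $$ (i, j') * M $$ (i', j)) =
        pmonom (L ^ Suc (i * j' + i' * j)) (a i j' + a i' j)"
      using ij by (simp add: M_def q pmonom_mult power_add)
    also have "\<dots> \<le> pmonom (L ^ (i * j + i' * j')) (a i j + a i' j')"
      using L power_increasing[OF exponent L] TN_trop2_monge[OF A a ij]
      by (intro pmonom_mono) auto
    also have "\<dots> = M $$ (i, j) * M $$ (i', j')"
      using ij by (simp add: M_def pmonom_mult power_add)
    finally show "fact n * (M $$ (i, j') * M $$ (i', j)) \<le> M $$ (i, j) * M $$ (i', j')" .
  qed
  then have "0 < det B" if B: "B \<in> square_submatrices M" for B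
  proof -
    obtain k where k: "B \<in> carrier_mat k k" "k \<le> n"
      using square_submatrices_carrier[OF B] by (auto simp: M_def)
    have "(fact k :: puiseux) \<le> fact n" using k(2) by (rule fact_mono)
    then show ?thesis
      using two_minors_dominate_submatrix[OF \<open>two_minors_dominate (fact n) M\<close> B] k(1)
      by (intro det_pos_if_two_minors_dominate)
  qed
  then have "M \<in> TP n m" by (simp add: TP_def M_def)
  moreover have "map_mat pval M = A"
    using carr a L by (intro eq_matI) (auto simp: M_def pval_pmonom)
  ultimately show "A \<in> val_set (TP n m)" unfolding val_set_def by blast
qed

lemma TP_subset_TN_nonzero: "TP n m \<subseteq> TN_nonzero n m"
proof
  fix A assume A: "A \<in> TP n m"
  have "A $$ (i, j) \<noteq> 0" if ij: "i < n" "j < m" for i j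
  proof -
    obtain B where B: "B \<in> square_submatrices A" "B \<in> carrier_mat 1 1" "B $$ (0, 0) = A $$ (i, j)"
      using entry_square_submatrix[of i A j] A ij by (auto simp: TP_def)
    then have "0 < det B" using A by (auto simp: TP_def)
    then show ?thesis using B det_single[OF B(2)] by auto
  qed
  then show "A \<in> TN_nonzero n m"
    using A by (auto simp: TP_def TN_nonzero_def TN_def less_imp_le)
qed

lemma TN_nonzero_two_minors_dominate:
  assumes "A \<in> TN_nonzero n m"
  shows "two_minors_dominate 1 A"
  unfolding two_minors_dominate_def
proof (intro conjI allI impI)
  fix i j assume ij: "i < dim_row A" "j < dim_col A"
  obtain B where B: "B \<in> square_submatrices A" "B \<in> carrier_mat 1 1" "B $$ (0, 0) = A $$ (i, j)"
    using entry_square_submatrix[OF ij] .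
  then have "0 \<le> A $$ (i, j)" using assms det_single[OF B(2)] by (auto simp: TN_nonzero_def TN_def)
  moreover have "A $$ (i, j) \<noteq> 0" using assms ij by (auto simp: TN_nonzero_def TN_def)
  ultimately show "0 < A $$ (i, j)" by simp
next
  fix i i' j j'
  assume ij: "i < i'" "i' < dim_row A" "j < j'" "j' < dim_col A"
  obtain B where B: "B \<in> square_submatrices A" "B \<in> carrier_mat 2 2"
    "B $$ (0, 0) = A $$ (i, j)" "B $$ (0, 1) = A $$ (i, j')"
    "B $$ (1, 0) = A $$ (i', j)" "B $$ (1, 1) = A $$ (i', j')"
    using two_by_two_square_submatrix[OF ij] .
  then have "0 \<le> det B" using assms by (auto simp: TN_nonzero_def TN_def)
  then show "1 * (A $$ (i, j') * A $$ (i', j)) \<le> A $$ (i, j) * A $$ (i', j')"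
    using det_two_by_two[OF B(2)] B(3-6) by simp
qed

text \<open>The tropical weight of a permutation is the valuation of the corresponding product of entries,
  and the valuation is monotone on positive elements.\<close>

lemma trop_nonneg_map_pval:
  assumes dom: "two_minors_dominate 1 B" and B: "B \<in> carrier_mat k k"
  shows "trop_nonneg (map_mat pval B)"
proof (rule trop_nonnegI)
  show "map_mat pval B \<in> carrier_mat k k" using B by simp
  fix \<sigma> assume \<sigma>: "\<sigma> permutes {0..<k}"
  have pos: "0 < B $$ (i, \<tau> i)" if "\<tau> permutes {0..<k}" "i < k" for \<tau> i
    using permutes_in_image[OF that(1), of i] that(2) dom B
    by (simp add: two_minors_dominate_def)
  have weight: "trop_weight (map_mat pval B) \<tau> = pval (\<Prod>i = 0..<k. B $$ (i, \<tau> i))"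
    if "\<tau> permutes {0..<k}" for \<tau>
  proof -
    have "\<tau> i < k" if "i < k" for i
      using permutes_in_image[OF \<open>\<tau> permutes {0..<k}\<close>, of i] that by simp
    then have "trop_weight (map_mat pval B) \<tau> = (\<Sum>i = 0..<k. pval (B $$ (i, \<tau> i)))"
      using B by (simp add: trop_weight_def)
    also have "\<dots> = pval (\<Prod>i = 0..<k. B $$ (i, \<tau> i))"
      using pos[OF that] by (intro pval_prod[symmetric]) force
    finally show ?thesis .
  qed
  show "trop_weight (map_mat pval B) \<sigma> \<le> trop_weight (map_mat pval B) id"
  proof (cases "\<sigma> = id")
    case False
    have "0 < (\<Prod>i = 0..<k. B $$ (i, \<sigma> i))" using pos[OF \<sigma>] by (intro prod_pos) auto
    then show ?thesis
      using two_minors_dominate_prod_le[OF dom order_refl B \<sigma> False] weight[OF \<sigma>]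
        weight[OF permutes_id] by (simp add: pval_mono)
  qed simp
qed

lemma val_TN_nonzero_subset_TN_trop: "val_set (TN_nonzero n m) \<subseteq> TN_trop n m"
proof
  fix V assume "V \<in> val_set (TN_nonzero n m)"
  then obtain A where A: "A \<in> TN_nonzero n m" and V: "V = map_mat pval A"
    by (auto simp: val_set_def)
  have "V \<in> real_mats n m"
    using A by (auto simp: V real_mats_def TN_nonzero_def TN_def pval_def)
  moreover have "trop_nonneg B" if "B \<in> square_submatrices V" for B
  proof -
    from that obtain C where C: "C \<in> square_submatrices A" and B: "B = map_mat pval C"
      unfolding V square_submatrices_map_mat by blast
    obtain k where "C \<in> carrier_mat k k" using square_submatrices_carrier[OF C] .
    then show ?thesis
      unfolding B using two_minors_dominate_submatrix[OF TN_nonzero_two_minors_dominate[OF A] C]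
      by (intro trop_nonneg_map_pval)
  qed
  ultimately show "V \<in> TN_trop n m" by (simp add: TN_trop_def)
qed

theorem theoremA:
  fixes n m :: nat
  assumes "n \<ge> 1" and "m \<ge> 1"
  shows "TN_trop2 n m = TN_trop n m \<and>
         TN_trop n m = val_set (TN_nonzero n m) \<and>
         val_set (TN_nonzero n m) = val_set (TP n m)"
proof -
  have "val_set (TP n m) \<subseteq> val_set (TN_nonzero n m)"
    unfolding val_set_def by (rule image_mono[OF TP_subset_TN_nonzero])
  then show ?thesis
    using TN_trop_subset_TN_trop2[of n m] TN_trop2_subset_val_TP[of n m]
      val_TN_nonzero_subset_TN_trop[of n m] by blast
qed

end
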